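(* Let $A$ be a $d\times d$ invertible matrix with integer entries, and let $T_A$ be the surjective endomorphism (epimorphism) of $\mathbb{T}^d$ induced by $A$. Then the following are equivalent: (i) $\overline{\{x\in\mathbb{T}^d: (T_A)^n x=0 \text{ for some } n\ge 0\}}\neq\mathbb{T}^d$; (ii) $A$ has an eigenvalue $\lambda\in\mathbb{C}$ which is an integral algebraic unit, i.e., both $\lambda$ and $1/\lambda$ are algebraic integers.
   Context: $\mathbb{T}^d=\mathbb{R}^d/\mathbb{Z}^d$ is the $d$-dimensional torus. "Invertible" means invertible as a real matrix ($\det A\neq 0$). The induced endomorphism is $T_A(x+\mathbb{Z}^d)=Ax+\mathbb{Z}^d$; it is surjective exactly when $A$ is invertible. *)

theory Defs
  imports "HOL-Analysis.Analysis" "HOL-Computational_Algebra.Polynomial"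
begin

definition torus_rel :: "real^'n \<Rightarrow> real^'n \<Rightarrow> bool" where
  "torus_rel x y \<longleftrightarrow> (\<forall>i. (x - y) $ i \<in> \<int>)"

lemma equivp_torus_rel: "equivp torus_rel"
proof (rule equivpI)
  show "reflp torus_rel" by (simp add: reflp_def torus_rel_def)
  show "symp torus_rel"
    unfolding symp_def torus_rel_def by (metis Ints_minus minus_diff_eq vector_uminus_component)
  show "transp torus_rel"
  proof (rule transpI)
    fix x y z :: "real^'n"
    assume "torus_rel x y" "torus_rel y z"
    then have "((x - y) + (y - z)) $ i \<in> \<int>" for i
      unfolding torus_rel_def vector_add_component by (meson Ints_add)
    then show "torus_rel x z" by (simp add: torus_rel_def)
  qed
qed

quotient_type 'n torus = "real^'n" / torus_rel
  by (rule equivp_torus_rel)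

instantiation torus :: (finite) ab_group_add
begin

lift_definition zero_torus :: "'a torus" is 0 .

lift_definition plus_torus :: "'a torus \<Rightarrow> 'a torus \<Rightarrow> 'a torus" is "(+)"
  unfolding torus_rel_def
  by (metis (no_types, opaque_lifting) Ints_add add_diff_add vector_add_component)

lift_definition uminus_torus :: "'a torus \<Rightarrow> 'a torus" is uminus
  unfolding torus_rel_def
  by (metis (no_types, opaque_lifting) Ints_minus minus_diff_minus vector_uminus_component)

definition minus_torus :: "'a torus \<Rightarrow> 'a torus \<Rightarrow> 'a torus" where
  "minus_torus x y = x + - y"

instance
proof
  fix a b c :: "'a torus"
  show "a + b + c = a + (b + c)" by transfer (simp add: torus_rel_def algebra_simps)
  show "a + b = b + a" by transfer (simp add: torus_rel_def algebra_simps)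
  show "0 + a = a" by transfer (simp add: torus_rel_def)
  show "- a + a = 0" by transfer (simp add: torus_rel_def)
  show "a - b = a + - b" by (rule minus_torus_def)
qed

end

text \<open>The torus carries the quotient topology with respect to the projection \<^const>\<open>abs_torus\<close>.\<close>

instantiation torus :: (finite) topological_space
begin

definition open_torus :: "'a torus set \<Rightarrow> bool" where
  "open_torus U \<longleftrightarrow> open (abs_torus -` U)"

instance
proof
  show "open (UNIV :: 'a torus set)" by (simp add: open_torus_def)
  fix S T :: "'a torus set"
  assume "open S" "open T"
  then show "open (S \<inter> T)" by (simp add: open_torus_def open_Int)
next
  fix K :: "'a torus set set"
  assume "\<forall>S\<in>K. open S"
  then show "open (\<Union>K)" by (simp add: open_torus_def vimage_Union open_UN)
qed

end

lift_definition torus_endo :: "int^'n^'n \<Rightarrow> 'n::finite torus \<Rightarrow> 'n torus" is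
  "\<lambda>A x. map_matrix real_of_int A *v x"
proof -
  fix A :: "int^'n^'n" and x y :: "real^'n"
  assume "torus_rel x y"
  then have "(map_matrix real_of_int A *v (x - y)) $ i \<in> \<int>" for i
    unfolding torus_rel_def matrix_vector_mult_def
    by (auto intro!: Ints_sum Ints_mult simp del: vector_minus_component)
  then show "torus_rel (map_matrix real_of_int A *v x) (map_matrix real_of_int A *v y)"
    by (simp add: torus_rel_def matrix_vector_mult_diff_distrib)
qed

definition is_eigenvalue :: "complex^'n^'n \<Rightarrow> complex \<Rightarrow> bool" where
  "is_eigenvalue M l \<longleftrightarrow> (\<exists>v. v \<noteq> 0 \<and> M *v v = l *s v)"

text \<open>The condition \<open>z \<noteq> 0\<close> is needed because \<open>1 / 0 = 0\<close> is an algebraic integer in HOL.\<close>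

definition algebraic_unit :: "complex \<Rightarrow> bool" where
  "algebraic_unit z \<longleftrightarrow> z \<noteq> 0 \<and> algebraic_int z \<and> algebraic_int (1 / z)"

end

theory Submission
  imports Defs "HOL-Computational_Algebra.Fundamental_Theorem_Algebra"
begin

text \<open>
Write \<open>G\<close> for the set of \<open>x \<in> \<real>\<^sup>d\<close> with \<open>A\<^sup>n x \<in> \<int>\<^sup>d\<close> for some \<open>n\<close>.  It is a subgroup of
\<open>\<real>\<^sup>d\<close> containing \<open>\<int>\<^sup>d\<close>, and it is the preimage under the projection of the set in (i); so (i)
says that \<open>G\<close> is not dense in \<open>\<real>\<^sup>d\<close>.  Both implications pass through a third condition: some
nonzero \<open>w \<in> \<int>\<^sup>d\<close> has integral inner product with every element of \<open>G\<close>.  Such a \<open>w\<close>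
exhibits \<open>G\<close> as a subset of a proper closed set, periodic under \<open>\<int>\<^sup>d\<close>, so it proves (i)
(\<open>not_dense_torus_if_functional\<close>).

Conversely, let \<open>G\<close> be a subgroup that spans \<open>\<real>\<^sup>d\<close> and is not dense.  For some \<open>e > 0\<close> the
elements of \<open>G\<close> of norm below \<open>e\<close> span only a proper subspace, because any basis made of tiny
elements of \<open>G\<close> has integer combinations close to every point.  Extend a basis of that subspace
to a basis of \<open>\<real>\<^sup>d\<close> inside \<open>G\<close> and let \<open>g\<close> be the coordinate along one of the added vectors.
Then \<open>g\<close> vanishes on the short elements of \<open>G\<close>, so it has the same value at any two elements of
\<open>G\<close> at distance below \<open>e\<close>.  As integer combinations of the basis move every element of \<open>G\<close> into
one bounded set and change \<open>g\<close> only by integers, it takes finitely many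
values on \<open>G\<close> modulo \<open>\<int>\<close>, and a multiple of \<open>g\<close> is integral on \<open>G\<close>
(\<open>nondense_subgroup_annihilator\<close>).

The rest is arithmetic of \<open>T = A\<^sup>t\<close>.  If \<open>\<lambda>\<close> is an eigenvalue and \<open>1/\<lambda>\<close> is an algebraic integer,
reversing the monic polynomial of \<open>1/\<lambda>\<close> gives \<open>r \<in> \<int>[X]\<close> with \<open>r(\<lambda>) = 0\<close> and \<open>r(0) = 1\<close>.  Then
\<open>r(T)\<close> is a singular integer matrix, and on its integral kernel \<open>T\<close> has an inverse that is an
integer polynomial in \<open>T\<close>.  Every \<open>w\<close> in this kernel can thus be divided by \<open>T\<close> arbitrarily often
within \<open>\<int>\<^sup>d\<close>, which is integrality on \<open>G\<close> (\<open>unit_eigenvalue_imp_annihilator\<close>).  In the other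
direction an integral functional \<open>w\<close> gives a chain of nonzero integer vectors \<open>u\<^sub>0 = w\<close>,
\<open>T u\<^sub>n\<^sub>+\<^sub>1 = u\<^sub>n\<close>.  As \<open>\<int>\<^sup>d\<close> is Noetherian, some \<open>u\<^sub>k\<close> is an integer combination of its
predecessors \<open>u\<^sub>i = T\<^sup>k\<^sup>-\<^sup>i u\<^sub>k\<close>; so \<open>q(T) u\<^sub>k = 0\<close> for an integer polynomial \<open>q\<close> with \<open>q(0) = 1\<close>,
and some root \<open>\<lambda>\<close> of \<open>q\<close> is an eigenvalue of \<open>T\<close>, with \<open>1/\<lambda>\<close> an algebraic integer
(\<open>annihilator_imp_unit_eigenvalue\<close>).  That \<open>\<lambda>\<close> itself is one holds for every eigenvalue of an
integer matrix.
\<close>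

section \<open>Polynomials evaluated at a matrix\<close>

text \<open>The scheme of Horner with the matrix product: multiplication and powers on the vector type itself are
componentwise.\<close>

definition matrix_poly :: "'a::comm_ring_1 poly \<Rightarrow> 'a^'n^'n \<Rightarrow> 'a^'n^'n" where
  "matrix_poly p M = fold_coeffs (\<lambda>a N. mat a + M ** N) p 0"

lemma matrix_poly_0 [simp]: "matrix_poly 0 M = 0"
  by (simp add: matrix_poly_def)

lemma matrix_poly_pCons [simp]:
  "matrix_poly (pCons a p) M = mat a + M ** matrix_poly p M"
  by (cases "p = 0 \<and> a = 0") (auto simp: matrix_poly_def vec_eq_iff mat_def matrix_matrix_mult_def)

lemma mat_mult_vec [simp]: "mat c *v (v :: 'a::comm_ring_1^'n) = c *s v"
  by (simp add: vec_eq_iff matrix_vector_mult_def mat_def if_distrib[of "\<lambda>x. x * _"] cong: if_cong)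

lemma matrix_mult_scale_vec: "M *v (c *s v) = c *s (M *v (v :: 'a::comm_ring_1^'n))"
  by (simp add: vec_eq_iff matrix_vector_mult_def sum_distrib_left algebra_simps)

lemma matrix_poly_commute_vec:
  "matrix_poly p M *v (M *v v) = M *v (matrix_poly p M *v v)"
  by (induction p arbitrary: v)
     (simp_all add: matrix_vector_mult_add_rdistrib matrix_vector_right_distrib
        matrix_mult_scale_vec matrix_vector_mul_assoc[symmetric])

lemma matrix_poly_add: "matrix_poly (p + q) M = matrix_poly p M + matrix_poly q M"
proof (induction p q rule: poly_induct2)
  case (pCons a p b q)
  have "mat (a + b) = mat a + (mat b :: 'a^'b^'b)" by (simp add: vec_eq_iff mat_def)
  then show ?case by (simp add: pCons matrix_add_ldistrib)
qed simp

lemma matrix_poly_smult: "matrix_poly (smult c p) M *v v = c *s (matrix_poly p M *v v)"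
  by (induction p)
     (simp_all add: matrix_vector_mult_add_rdistrib matrix_mult_scale_vec
        matrix_vector_mul_assoc[symmetric] vector_smult_assoc vector_add_ldistrib)

text \<open>Stated after application to a vector: with the matrix product turned into composition of maps,
only linearity is needed.\<close>

lemma matrix_poly_mult:
  "matrix_poly (p * q) M *v v = matrix_poly p M *v (matrix_poly q M *v v)"
  by (induction p)
     (simp_all add: matrix_poly_add matrix_poly_smult matrix_vector_mult_add_rdistrib
        matrix_vector_mul_assoc[symmetric] vector_smult_lzero)

lemma matrix_poly_eigenvector:
  assumes "M *v v = l *s v"
  shows "matrix_poly p M *v v = poly p l *s v"
  by (induction p)
     (simp_all add: matrix_vector_mult_add_rdistrib matrix_mult_scale_vec assms
        matrix_vector_mul_assoc[symmetric] vector_smult_assoc vector_sadd_rdistrib mult.commute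
        vector_smult_lzero)

lemma map_matrix_of_int_poly:
  "map_matrix (of_int :: int \<Rightarrow> 'a::comm_ring_1) (matrix_poly p M)
     = matrix_poly (map_poly of_int p) (map_matrix of_int M)"
  by (induction p) (auto simp: map_poly_pCons vec_eq_iff matrix_matrix_mult_def mat_def)

lemma map_matrix_mult_of_int:
  "map_matrix of_int M *v (\<chi> i. of_int (v $ i)) = ((\<chi> i. of_int ((M *v v) $ i)) :: 'a::comm_ring_1^'n)"
  by (simp add: vec_eq_iff matrix_vector_mult_def)

lemma det_map_of_int: "det (map_matrix of_int M) = (of_int (det M) :: 'a::comm_ring_1)"
  by (simp add: det_def)

text \<open>The determinant commutes with the embeddings of the integers, so this criterion moves singularity
of an integer matrix between the complex and the rational numbers.\<close>

lemma singular_iff_kernel: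
  fixes M :: "'a::field^'n^'n"
  shows "det M = 0 \<longleftrightarrow> (\<exists>v. v \<noteq> 0 \<and> M *v v = 0)"
  using invertible_det_nz[of M] invertible_left_inverse[of M] matrix_left_invertible_ker[of M]
  by metis

lemma is_eigenvalue_transpose:
  "is_eigenvalue (transpose M) l \<longleftrightarrow> is_eigenvalue M l"
proof -
  have *: "is_eigenvalue N l \<longleftrightarrow> det (N - mat l) = 0" for N :: "complex^'a^'a"
    by (simp add: is_eigenvalue_def singular_iff_kernel matrix_vector_mult_diff_rdistrib)
  have "transpose M - mat l = transpose (M - mat l)"
    by (simp add: vec_eq_iff transpose_def mat_def)
  then show ?thesis by (simp add: * det_transpose)
qed

text \<open>Factor \<open>p = (X - r) q\<close> over the complex numbers: either \<open>q(M) w\<close> is an eigenvector for \<open>r\<close>, or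
it vanishes and \<open>q\<close> has smaller degree.\<close>

lemma matrix_poly_kernel_imp_eigenvalue:
  fixes M :: "complex^'n^'n"
  assumes "p \<noteq> 0" "matrix_poly p M *v w = 0" "w \<noteq> 0"
  shows "\<exists>l. poly p l = 0 \<and> is_eigenvalue M l"
  using assms
proof (induction "degree p" arbitrary: p)
  case 0
  then obtain c where "p = [:c:]" by (metis degree_eq_zeroE)
  with 0 show ?case by (auto simp: matrix_vector_mult_add_rdistrib vec_eq_iff)
next
  case (Suc n)
  then have "\<not> constant (poly p)" by (simp add: constant_degree)
  then obtain r where r: "poly p r = 0" using fundamental_theorem_of_algebra by blast
  then obtain q where q: "p = [:-r, 1:] * q" by (auto simp: poly_eq_0_iff_dvd)
  show ?case
  proof (cases "matrix_poly q M *v w = 0")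
    case True
    have "q \<noteq> 0" using q Suc.prems by auto
    moreover have "degree p = Suc (degree q)" unfolding q using \<open>q \<noteq> 0\<close> by (subst degree_mult_eq) auto
    ultimately obtain l where "poly q l = 0" "is_eigenvalue M l"
      using Suc.hyps True Suc.prems by (metis Suc_inject)
    then show ?thesis using q by auto
  next
    case False
    define u where "u = matrix_poly q M *v w"
    have "matrix_poly [:-r, 1:] M *v u = 0"
      using Suc.prems(2) unfolding q u_def matrix_poly_mult .
    then have "M *v u = r *s u"
      by (simp add: matrix_vector_mult_add_rdistrib matrix_vector_mul_assoc[symmetric] vec_eq_iff)
    then show ?thesis using False r by (auto simp: u_def is_eigenvalue_def)
  qed
qed

lemma algebraic_int_of_int_poly:
  fixes x :: complex
  assumes "lead_coeff p = 1" "poly (map_poly of_int p) x = 0"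
  shows "algebraic_int x"
  using assms by (auto simp: algebraic_int_altdef_ipoly)

section \<open>Finite generation of lattices and integral eigenvalues\<close>

interpretation int_vec: module "(*s) :: int \<Rightarrow> int^'n \<Rightarrow> int^'n"
  by unfold_locales (simp_all add: vec_eq_iff algebra_simps)

text \<open>The Noetherian property of \<open>\<int>\<^sup>d\<close>, by induction on the coordinates that may be nonzero.  The
\<open>i\<close>-th coordinates of \<open>L\<close> form an ideal of \<open>\<int>\<close>; an element of \<open>L\<close> whose \<open>i\<close>-th coordinate
generates this ideal, together with generators of the part of \<open>L\<close> where it vanishes, generates \<open>L\<close>.\<close>

lemma int_subspace_finitely_generated:
  assumes "finite I" "int_vec.subspace L" "\<And>x i. x \<in> L \<Longrightarrow> i \<notin> I \<Longrightarrow> x $ i = 0"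
  shows "\<exists>S. finite S \<and> S \<subseteq> L \<and> L \<subseteq> int_vec.span S"
  using assms
proof (induction I arbitrary: L rule: finite_induct)
  case empty
  then have "L \<subseteq> {0}" by (auto simp: vec_eq_iff)
  then show ?case by (intro exI[of _ "{}"]) auto
next
  case (insert i I)
  define L' where "L' = {x\<in>L. x $ i = 0}"
  have "int_vec.subspace L'"
    using insert.prems(1) by (auto simp: L'_def int_vec.subspace_def)
  moreover have "x $ j = 0" if "x \<in> L'" "j \<notin> I" for x j
    using that insert.prems(2)[of x j] by (auto simp: L'_def)
  ultimately obtain S where S: "finite S" "S \<subseteq> L'" "L' \<subseteq> int_vec.span S"
    using insert.IH[of L'] by auto
  show ?case
  proof (cases "L \<subseteq> L'")
    case True
    then show ?thesis using S by (auto simp: L'_def)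
  next
    case False
    then obtain u where u: "u \<in> L \<and> u $ i \<noteq> 0" by (auto simp: L'_def)
    obtain v where v: "v \<in> L" "v $ i \<noteq> 0"
      and min: "\<And>u. u \<in> L \<and> u $ i \<noteq> 0 \<Longrightarrow> nat \<bar>v $ i\<bar> \<le> nat \<bar>u $ i\<bar>"
      using ex_has_least_nat[of "\<lambda>v. v \<in> L \<and> v $ i \<noteq> 0" u "\<lambda>v. nat \<bar>v $ i\<bar>", OF u] by metis
    have "x \<in> int_vec.span (insert v S)" if x: "x \<in> L" for x
    proof -
      define u where "u = x - (x $ i div v $ i) *s v"
      have uL: "u \<in> L"
        unfolding u_def using insert.prems(1) x v(1)
        by (intro int_vec.subspace_diff int_vec.subspace_scale)
      have ui: "u $ i = x $ i mod v $ i" by (simp add: u_def minus_div_mult_eq_mod)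
      have "\<bar>u $ i\<bar> < \<bar>v $ i\<bar>" unfolding ui using v(2) by (rule abs_mod_less)
      then have "u $ i = 0" using min[of u] uL by linarith
      then have "u \<in> int_vec.span S" using uL S by (auto simp: L'_def)
      then show ?thesis by (auto simp: int_vec.span_insert u_def)
    qed
    then show ?thesis using S v(1) by (intro exI[of _ "insert v S"]) (auto simp: L'_def)
  qed
qed

text \<open>The generators of the span of the whole sequence already lie in the span of an initial segment.\<close>

lemma int_vec_sequence_dependent:
  fixes w :: "nat \<Rightarrow> int^'n"
  shows "\<exists>k c. w k = (\<Sum>i<k. c i *s w i)"
proof -
  let ?L = "int_vec.span (range w)"
  obtain S where S: "finite S" "S \<subseteq> ?L" "?L \<subseteq> int_vec.span S"
    using int_subspace_finitely_generated[of UNIV ?L] by auto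
  have ex: "\<exists>k. s \<in> int_vec.span (w ` {..<k})" if "s \<in> S" for s
  proof -
    obtain t r where t: "finite t" "t \<subseteq> range w" "s = (\<Sum>a\<in>t. r a *s a)"
      using S(2) \<open>s \<in> S\<close> unfolding int_vec.span_explicit by blast
    obtain C where "finite C" "t = w ` C" using finite_subset_image[OF t(1,2)] by auto
    moreover obtain k where "C \<subseteq> {..<k}" using \<open>finite C\<close> finite_nat_iff_bounded by blast
    ultimately have "t \<subseteq> w ` {..<k}" by auto
    then show ?thesis using t unfolding int_vec.span_explicit by blast
  qed
  then obtain f where f: "\<And>s. s \<in> S \<Longrightarrow> s \<in> int_vec.span (w ` {..<f s})" by metis
  define k where "k = (\<Sum>s\<in>S. f s)"
  have "S \<subseteq> int_vec.span (w ` {..<k})"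
  proof
    fix s assume s: "s \<in> S"
    have "f s \<le> k" unfolding k_def using S(1) s by (intro member_le_sum) auto
    then have "int_vec.span (w ` {..<f s}) \<subseteq> int_vec.span (w ` {..<k})"
      by (intro int_vec.span_mono image_mono) auto
    then show "s \<in> int_vec.span (w ` {..<k})" using f[OF s] by auto
  qed
  then have "int_vec.span S \<subseteq> int_vec.span (w ` {..<k})"
    by (simp add: int_vec.span_minimal)
  then have wk: "w k \<in> int_vec.span (w ` {..<k})"
    using S(3) int_vec.span_base[of "w k" "range w"] by auto
  have "x \<in> int_vec.span (w ` {..<k}) \<Longrightarrow> \<exists>c. x = (\<Sum>i<k. c i *s w i)" for x
  proof (induction rule: int_vec.span_induct_alt)
    case base
    show ?case by (intro exI[of _ "\<lambda>_. 0"]) simp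
  next
    case (step a x y)
    then obtain j c where j: "j < k" "x = w j" and y: "y = (\<Sum>i<k. c i *s w i)" by auto
    have "(\<Sum>i<k. (c i + (if i = j then a else 0)) *s w i)
        = (\<Sum>i<k. c i *s w i) + (\<Sum>i<k. if i = j then a *s w i else 0)"
      unfolding sum.distrib[symmetric]
      by (intro sum.cong) (auto simp: vector_sadd_rdistrib)
    also have "\<dots> = a *s x + y" using j y by (simp add: add.commute)
    finally show ?case by metis
  qed
  then show ?thesis using wk by blast
qed

text \<open>Pairing the integer row vectors \<open>e\<^sub>i M\<^sup>k\<close> with an eigenvector \<open>v\<close> yields \<open>l\<^sup>k v\<^sub>i\<close>, so an integer
relation expressing one of these rows through the earlier ones becomes a monic equation for \<open>l\<close>.\<close>

lemma eigenvalue_int_matrix_algebraic_int: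
  fixes M :: "int^'n^'n"
  assumes "is_eigenvalue (map_matrix of_int M) l"
  shows "algebraic_int l"
proof -
  obtain v where v: "v \<noteq> 0" "map_matrix of_int M *v v = l *s v"
    using assms by (auto simp: is_eigenvalue_def)
  obtain i where i: "v $ i \<noteq> 0" using v(1) by (auto simp: vec_eq_iff)
  define r :: "nat \<Rightarrow> int^'n" where "r = (\<lambda>k. ((\<lambda>x. x v* M) ^^ k) (axis i 1))"
  define pair :: "int^'n \<Rightarrow> complex" where "pair = (\<lambda>x. \<Sum>j\<in>UNIV. of_int (x $ j) * v $ j)"
  have pair_step: "pair (x v* M) = l * pair x" for x
  proof -
    have "pair (x v* M) = (\<Sum>j\<in>UNIV. \<Sum>h\<in>UNIV. of_int (x $ h) * of_int (M $ h $ j) * v $ j)"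
      by (simp add: pair_def vector_matrix_mult_def sum_distrib_left mult_ac)
    also have "\<dots> = (\<Sum>h\<in>UNIV. of_int (x $ h) * (\<Sum>j\<in>UNIV. of_int (M $ h $ j) * v $ j))"
      by (subst sum.swap) (simp add: sum_distrib_left mult.assoc)
    also have "\<dots> = (\<Sum>h\<in>UNIV. of_int (x $ h) * (l * v $ h))"
      using v(2) by (simp add: vec_eq_iff matrix_vector_mult_def)
    finally show ?thesis by (simp add: pair_def sum_distrib_left algebra_simps)
  qed
  have pair_r: "pair (r k) = l ^ k * v $ i" for k
  proof (induction k)
    case 0
    have "of_int (axis i 1 $ j) * v $ j = (if j = i then v $ i else 0)" for j
      by (simp add: axis_def)
    then show ?case by (simp add: r_def pair_def)
  next
    case (Suc k)
    then show ?case by (simp add: r_def pair_step)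
  qed
  \<comment> \<open>The relation between the rows; its image under the pairing can be divided by the nonzero \<open>v\<^sub>i\<close>.\<close>
  obtain k c where k: "r k = (\<Sum>j<k. c j *s r j)" using int_vec_sequence_dependent by blast
  have "pair (r k) = (\<Sum>h\<in>UNIV. \<Sum>j<k. of_int (c j) * (of_int (r j $ h) * v $ h))"
    unfolding k pair_def by (simp add: sum_distrib_right mult.assoc)
  also have "\<dots> = (\<Sum>j<k. of_int (c j) * pair (r j))"
    unfolding pair_def by (subst sum.swap) (simp add: sum_distrib_left)
  finally have "pair (r k) = (\<Sum>j<k. of_int (c j) * pair (r j))" .
  then have "l ^ k * v $ i = (\<Sum>j<k. of_int (c j) * l ^ j) * v $ i"
    by (simp add: pair_r sum_distrib_right mult.assoc)
  then have lk: "l ^ k = (\<Sum>j<k. of_int (c j) * l ^ j)" using i by simp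
  define q where "q = (\<Sum>j<k. monom (of_int (c j) :: complex) j)"
  define p where "p = monom 1 k - q"
  have cq: "coeff q n = (if n < k then of_int (c n) else 0)" for n
    by (simp add: q_def coeff_sum)
  have "coeff p n = (if n = k then 1 else if n < k then - of_int (c n) else 0)" for n
    by (simp add: p_def cq)
  moreover from this have "degree p = k"
    by (intro antisym degree_le le_degree) auto
  moreover have "poly p l = 0" by (simp add: p_def q_def poly_sum poly_monom lk)
  ultimately show ?thesis
    by (intro algebraic_int.intros[of p]) auto
qed

text \<open>A kernel vector exists over the rational numbers, and clearing denominators makes it integral.\<close>

lemma singular_int_matrix_kernel:
  fixes M :: "int^'n^'n"
  assumes "det M = 0"
  shows "\<exists>w. w \<noteq> 0 \<and> M *v w = 0"
proof -
  have "det (map_matrix of_int M :: rat^'n^'n) = 0" by (simp add: det_map_of_int assms)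
  then obtain v :: "rat^'n" where v: "v \<noteq> 0" "map_matrix of_int M *v v = 0"
    by (auto simp: singular_iff_kernel)
  define d where "d = (\<Prod>i\<in>UNIV. snd (quotient_of (v $ i)))"
  have d0: "d > 0" unfolding d_def by (intro prod_pos) (auto simp: quotient_of_denom_pos')
  have "\<exists>a. of_int d * v $ i = (of_int a :: rat)" for i
  proof -
    obtain a b where ab: "quotient_of (v $ i) = (a, b)" by fastforce
    define e where "e = (\<Prod>j\<in>UNIV - {i}. snd (quotient_of (v $ j)))"
    have d: "d = b * e" unfolding d_def e_def using prod.remove[of UNIV i "\<lambda>i. snd (quotient_of (v $ i))"] ab by simp
    have v: "v $ i = of_int a / of_int b" using ab by (rule quotient_of_div)
    have "b \<noteq> 0" using quotient_of_denom_pos[OF ab] by simp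
    then have "of_int d * v $ i = of_int (a * e)" by (simp add: d v)
    then show ?thesis by blast
  qed
  then obtain a where a: "\<And>i. of_int d * v $ i = (of_int (a i) :: rat)" by metis
  define w where "w = (\<chi> i. a i)"
  have w: "(\<chi> i. of_int (w $ i)) = of_int d *s v" by (simp add: w_def vec_eq_iff a)
  have "(\<chi> i. of_int ((M *v w) $ i)) = (0 :: rat^'n)"
    by (simp add: map_matrix_mult_of_int[symmetric] w matrix_mult_scale_vec v)
  then have "M *v w = 0" by (simp add: vec_eq_iff)
  moreover have "w \<noteq> 0"
  proof
    assume "w = 0"
    then have "of_int d *s v = 0" unfolding w[symmetric] by (simp add: vec_eq_iff)
    then show False using v(1) d0 by (auto simp: vec_eq_iff)
  qed
  ultimately show ?thesis by blast
qed

section \<open>Non-dense subgroups of Euclidean space\<close>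

text \<open>Rounding the coordinates of \<open>x\<close> down leaves coefficients in \<open>[0,1)\<close>.\<close>

lemma integer_rounding:
  fixes B :: "'a::real_normed_vector set"
  assumes "finite B" "x \<in> span B"
  shows "\<exists>c :: 'a \<Rightarrow> int. norm (x - (\<Sum>b\<in>B. of_int (c b) *\<^sub>R b)) \<le> (\<Sum>b\<in>B. norm b)"
proof -
  obtain u where u: "x = (\<Sum>b\<in>B. u b *\<^sub>R b)"
    using assms by (auto simp: span_finite)
  have "norm (x - (\<Sum>b\<in>B. of_int \<lfloor>u b\<rfloor> *\<^sub>R b)) = norm (\<Sum>b\<in>B. frac (u b) *\<^sub>R b)"
    by (simp add: u sum_subtractf[symmetric] scaleR_diff_left[symmetric] frac_def)
  also have "\<dots> \<le> (\<Sum>b\<in>B. norm b)"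
  proof (rule sum_norm_le)
    fix b
    have "\<bar>frac (u b)\<bar> * norm b \<le> 1 * norm b"
      using frac_lt_1[of "u b"] by (intro mult_right_mono) auto
    then show "norm (frac (u b) *\<^sub>R b) \<le> norm b" by simp
  qed
  finally show ?thesis by (rule exI[of _ "\<lambda>b. \<lfloor>u b\<rfloor>"])
qed

locale additive_subgroup =
  fixes H :: "'a::ab_group_add set"
  assumes zero: "0 \<in> H" and diff: "\<And>x y. x \<in> H \<Longrightarrow> y \<in> H \<Longrightarrow> x - y \<in> H"
begin

lemma add: "x \<in> H \<Longrightarrow> y \<in> H \<Longrightarrow> x + y \<in> H"
  using diff[of x "0 - y"] diff[OF zero, of y] by simp

end

lemma additive_subgroup_int_multiple:
  fixes H :: "'a::real_vector set"
  assumes "additive_subgroup H" "x \<in> H"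
  shows "of_int k *\<^sub>R x \<in> H"
proof -
  interpret additive_subgroup H by fact
  show ?thesis
  proof (induction k rule: int_induct[of _ 0])
    case base show ?case by (simp add: zero)
  next
    case (step1 i) then show ?case using add assms(2) by (simp add: scaleR_add_left)
  next
    case (step2 i) then show ?case using diff assms(2) by (simp add: scaleR_diff_left)
  qed
qed

lemma additive_subgroup_int_combination:
  fixes H :: "'a::real_vector set"
  assumes "additive_subgroup H" "B \<subseteq> H"
  shows "(\<Sum>b\<in>B. of_int (c b) *\<^sub>R b) \<in> H"
proof -
  interpret additive_subgroup H by fact
  show ?thesis
    using assms(2)
    by (induction B rule: infinite_finite_induct)
       (auto simp: zero intro!: add additive_subgroup_int_multiple assms(1))
qed

text \<open>If a basis consists of elements of \<open>H\<close> of norm below \<open>e / (2 d)\<close>, then rounding coordinates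
moves a point by less than \<open>e\<close>.\<close>

lemma subgroup_dense_if_small_elements_span:
  fixes H :: "'a::euclidean_space set"
  assumes H: "additive_subgroup H" and span: "\<And>e. e > 0 \<Longrightarrow> span (H \<inter> ball 0 e) = UNIV"
  shows "closure H = UNIV"
proof -
  have "\<exists>y\<in>H. dist y x < e" if "e > 0" for x e
  proof -
    define \<delta> where "\<delta> = e / (2 * DIM('a))"
    have \<delta>: "\<delta> > 0" using that by (simp add: \<delta>_def)
    obtain B where B: "B \<subseteq> H \<inter> ball 0 \<delta>" "independent B" "H \<inter> ball 0 \<delta> \<subseteq> span B"
      using maximal_independent_subset by blast
    have "span B = UNIV" using span[OF \<delta>] B(3) by (metis span_mono span_span top.extremum_uniqueI)
    then obtain c where c: "norm (x - (\<Sum>b\<in>B. of_int (c b) *\<^sub>R b)) \<le> (\<Sum>b\<in>B. norm b)"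
      using integer_rounding[of B x] independent_imp_finite[OF B(2)] by auto
    have "(\<Sum>b\<in>B. norm b) \<le> of_nat (card B) * \<delta>"
      using B(1) by (intro sum_bounded_above) (auto simp: less_imp_le)
    also have "\<dots> \<le> DIM('a) * \<delta>"
      using independent_bound[OF B(2)] \<delta> by (intro mult_right_mono) auto
    also have "\<dots> < e" using that by (simp add: \<delta>_def)
    finally have "dist (\<Sum>b\<in>B. of_int (c b) *\<^sub>R b) x < e"
      using c by (simp add: dist_norm norm_minus_commute)
    then show ?thesis
      using additive_subgroup_int_combination[OF H, of B c] B(1) by blast
  qed
  then show ?thesis by (auto simp: closure_approachable)
qed

text \<open>By the pigeonhole principle two of the multiples \<open>0, x, ..., N x\<close> with \<open>N = card F\<close> agree modulo
\<open>\<int>\<close>, so \<open>m x\<close> is an integer for some \<open>1 \<le> m \<le> N\<close>.  The factorial serves all \<open>m\<close>, and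
therefore all \<open>x\<close> with residues in \<open>F\<close>, at once.\<close>

lemma common_denominator_of_finitely_many_residues:
  fixes F :: "real set"
  assumes "finite F" and res: "\<And>k::nat. \<exists>f\<in>F. of_nat k * x - f \<in> \<int>"
  shows "fact (card F) * x \<in> \<int>"
proof -
  obtain f where f: "\<And>k. f k \<in> F" "\<And>k. of_nat k * x - f k \<in> \<int>" using res by metis
  have "f ` {..card F} \<subseteq> F" using f(1) by auto
  then have "card (f ` {..card F}) < card {..card F}"
    using card_mono[OF \<open>finite F\<close>, of "f ` {..card F}"] by simp
  then have "\<not> inj_on f {..card F}" by (rule pigeonhole)
  then obtain a b where ab: "a \<le> card F" "b \<le> card F" "f a = f b" "a \<noteq> b"
    by (auto simp: inj_on_def)
  define i j where "i = min a b" and "j = max a b"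
  have ij: "i < j" "j \<le> card F" "f i = f j"
    using ab by (auto simp: i_def j_def min_def max_def)
  have "(of_nat j * x - f j) - (of_nat i * x - f i) \<in> \<int>" by (intro Ints_diff f(2))
  then have ji: "of_nat (j - i) * x \<in> \<int>" using ij by (simp add: of_nat_diff algebra_simps)
  have "j - i dvd fact (card F)" using ij by (intro dvd_fact) auto
  then obtain m where m: "fact (card F) = (j - i) * m" by blast
  have fx: "fact (card F) * x = of_nat m * (of_nat (j - i) * x)"
    by (metis m mult.assoc mult.commute of_nat_fact of_nat_mult)
  show ?thesis unfolding fx by (intro Ints_mult Ints_of_nat ji)
qed

text \<open>The duality fact behind the theorem: a non-dense subgroup spanning the space is annihilated, modulo
\<open>\<int>\<close>, by a nonzero functional.  The functional is a multiple of a coordinate function \<open>g\<close> that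
vanishes on all short elements of \<open>H\<close>.\<close>

lemma nondense_subgroup_annihilator:
  fixes H :: "'a::euclidean_space set"
  assumes H: "additive_subgroup H" and spanH: "span H = UNIV" and nd: "closure H \<noteq> UNIV"
  shows "\<exists>w. w \<noteq> 0 \<and> (\<forall>h\<in>H. w \<bullet> h \<in> \<int>)"
proof -
  interpret additive_subgroup H by fact
  obtain e where e: "e > 0" "span (H \<inter> ball 0 e) \<noteq> UNIV"
    using subgroup_dense_if_small_elements_span[OF H] nd by blast
  define U where "U = H \<inter> ball 0 e"
  \<comment> \<open>A basis \<open>B\<close> inside \<open>H\<close> that extends a basis \<open>C\<close> of the span of the short elements.\<close>
  obtain C where C: "C \<subseteq> U" "independent C" "U \<subseteq> span C"
    using maximal_independent_subset by blast
  obtain B where B: "C \<subseteq> B" "B \<subseteq> H" "independent B" "H \<subseteq> span B"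
    using maximal_independent_subset_extend[of C H] C U_def by blast
  have spanB: "span B = UNIV" using B(4) spanH by (metis span_mono span_span top.extremum_uniqueI)
  have finB: "finite B" using B(3) by (rule independent_imp_finite)
  have "C \<noteq> B" using C(1) e(2) spanB span_mono[of C U] by (auto simp: U_def)
  then obtain b0 where b0: "b0 \<in> B" "b0 \<notin> C" using B(1) by blast
  obtain g :: "'a \<Rightarrow> real" where g: "linear g" "\<And>b. b \<in> B \<Longrightarrow> g b = (if b = b0 then 1 else 0)"
    using linear_independent_extend[OF B(3), of "\<lambda>b. if b = b0 then 1 else 0"] by blast
  interpret g: linear g by fact
  have gU: "g x = 0" if "x \<in> U" for x
  proof -
    have "\<And>c. c \<in> C \<Longrightarrow> g c = 0" using g(2) B(1) b0(2) by auto
    then show ?thesis using linear_eq_0_on_span[OF g(1), of C x] that C(3) by blast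
  qed
  \<comment> \<open>\<open>R\<close> is the rounding error for \<open>B\<close>, and \<open>F\<close> represents all of \<open>g(H)\<close> modulo \<open>\<int>\<close>.\<close>
  define R where "R = (\<Sum>b\<in>B. norm b)"
  define F where "F = g ` (H \<inter> cball 0 R)"
  have "finite F"
  proof -
    obtain K where K: "finite K" "cball 0 R \<subseteq> (\<Union>x\<in>K. ball (x::'a) (e/2))"
      using compact_cball[of "0::'a" R] e(1) unfolding compact_eq_totally_bounded
      by (meson half_gt_zero)
    \<comment> \<open>Two elements of \<open>H\<close> in one ball of radius \<open>e/2\<close> differ by a short element, where \<open>g\<close> vanishes.\<close>
    have "\<exists>y. g ` (H \<inter> ball x (e/2)) \<subseteq> {y}" for x
    proof -
      have "g h = g k" if "h \<in> H \<inter> ball x (e/2)" "k \<in> H \<inter> ball x (e/2)" for h k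
      proof -
        have "dist h k < e" using that dist_triangle_half_r[of x h e k] by auto
        then have "h - k \<in> U" using that diff by (simp add: U_def dist_norm norm_minus_commute)
        then show ?thesis using gU[of "h - k"] by (simp add: g.diff)
      qed
      then show ?thesis by blast
    qed
    then have "finite (g ` (H \<inter> ball x (e/2)))" for x by (meson finite.simps finite_subset)
    then have "finite (\<Union>x\<in>K. g ` (H \<inter> ball x (e/2)))" using K(1) by blast
    moreover have "F \<subseteq> (\<Union>x\<in>K. g ` (H \<inter> ball x (e/2)))" using K(2) unfolding F_def by blast
    ultimately show ?thesis by (rule finite_subset[rotated])
  qed
  \<comment> \<open>Subtracting an integer combination of \<open>B\<close> moves \<open>h\<close> into the ball and changes \<open>g h\<close> by an integer.\<close>
  have res: "\<exists>f\<in>F. g h - f \<in> \<int>" if "h \<in> H" for h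
  proof -
    obtain c where c: "norm (h - (\<Sum>b\<in>B. of_int (c b) *\<^sub>R b)) \<le> R"
      using integer_rounding[OF finB, of h] spanB by (auto simp: R_def)
    let ?r = "\<Sum>b\<in>B. of_int (c b) *\<^sub>R b"
    have "h - ?r \<in> H \<inter> cball 0 R"
      using c diff[OF that additive_subgroup_int_combination[OF H B(2)]] by simp
    moreover have "g ?r \<in> \<int>" by (auto simp: g.sum g.scaleR g(2) intro!: Ints_sum)
    ultimately show ?thesis
      unfolding F_def by (intro bexI[of _ "g (h - ?r)"] imageI) (simp_all add: g.diff)
  qed
  have gN: "fact (card F) * g h \<in> \<int>" if "h \<in> H" for h
  proof (rule common_denominator_of_finitely_many_residues[OF \<open>finite F\<close>])
    fix k :: nat
    have "of_int (int k) *\<^sub>R h \<in> H" by (rule additive_subgroup_int_multiple[OF H that])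
    from res[OF this] show "\<exists>f\<in>F. of_nat k * g h - f \<in> \<int>" by (simp add: g.scaleR)
  qed
  \<comment> \<open>The vector representing the functional \<open>N! g\<close> with \<open>N = card F\<close>.\<close>
  define w where "w = (\<Sum>b\<in>Basis. (fact (card F) * g b) *\<^sub>R b)"
  have w: "w \<bullet> x = fact (card F) * g x" for x
  proof -
    have "g x = g (\<Sum>b\<in>Basis. (x \<bullet> b) *\<^sub>R b)" by (simp add: euclidean_representation)
    also have "\<dots> = (\<Sum>b\<in>Basis. (x \<bullet> b) * g b)" by (simp add: g.sum g.scaleR)
    finally show ?thesis
      by (simp add: w_def inner_sum_left inner_sum_right sum_distrib_left inner_commute[of _ x] mult_ac)
  qed
  have "w \<bullet> b0 \<noteq> 0" by (simp add: w g(2) b0)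
  then have "w \<noteq> 0" by auto
  moreover have "\<forall>h\<in>H. w \<bullet> h \<in> \<int>" using gN by (simp add: w)
  ultimately show ?thesis by blast
qed

section \<open>Passing between the torus and Euclidean space\<close>

definition int_vectors :: "(real^'n) set" where
  "int_vectors = {x. \<forall>i. x $ i \<in> \<int>}"

definition eventually_integral :: "int^'n^'n \<Rightarrow> (real^'n) set" where
  "eventually_integral A = {x. \<exists>n. (((*v) (map_matrix of_int A)) ^^ n) x \<in> int_vectors}"

lemma abs_torus_eq_0_iff: "abs_torus x = 0 \<longleftrightarrow> x \<in> int_vectors"
  by (simp add: zero_torus_def torus.abs_eq_iff torus_rel_def int_vectors_def)

lemma torus_endo_funpow_abs:
  "(torus_endo A ^^ n) (abs_torus x) = abs_torus ((((*v) (map_matrix of_int A)) ^^ n) x)"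
  by (induction n) (simp_all add: torus_endo.abs_eq)

lemma surj_abs_torus: "\<exists>x. t = abs_torus x"
  using Quotient3_abs_rep[OF Quotient3_torus] by metis

lemma vimage_torsion_eq_eventually_integral:
  "abs_torus -` {x. \<exists>n. (torus_endo A ^^ n) x = 0} = eventually_integral A"
  by (auto simp: torus_endo_funpow_abs abs_torus_eq_0_iff eventually_integral_def)

text \<open>The projection is continuous, so an open set missing \<open>S\<close> pulls back to one missing the preimage.\<close>

lemma closure_vimage_abs_torus_neq_UNIV:
  assumes "closure (S :: 'n::finite torus set) \<noteq> UNIV"
  shows "closure (abs_torus -` S) \<noteq> UNIV"
proof -
  obtain t where t: "t \<notin> closure S" using assms by blast
  obtain x where x: "t = abs_torus x" using surj_abs_torus by blast
  have "open (abs_torus -` (- closure S))"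
    unfolding open_torus_def[symmetric] by (rule open_Compl) simp
  moreover have "x \<in> abs_torus -` (- closure S)" using t x by simp
  moreover have "abs_torus -` (- closure S) \<inter> abs_torus -` S = {}"
    using closure_subset[of S] by auto
  ultimately show ?thesis
    by (metis UNIV_I disjoint_iff open_Int_closure_eq_empty)
qed

text \<open>The set where \<open>w \<bullet> x\<close> is not an integer is open and invariant under integer translations, so its
image in the torus is open; it is nonempty, since a suitable multiple of \<open>w\<close> has inner product \<open>1/2\<close> with \<open>w\<close>.\<close>

lemma not_dense_torus_if_functional:
  assumes "w \<noteq> 0" and int: "\<And>x. x \<in> int_vectors \<Longrightarrow> w \<bullet> x \<in> \<int>"
    and S: "\<And>x. abs_torus x \<in> S \<Longrightarrow> w \<bullet> x \<in> \<int>"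
  shows "closure (S :: 'n::finite torus set) \<noteq> UNIV"
proof -
  define V :: "'n torus set" where "V = abs_torus ` {x. w \<bullet> x \<notin> \<int>}"
  have "abs_torus -` V = {x. w \<bullet> x \<notin> \<int>}"
  proof -
    have "w \<bullet> x \<notin> \<int>" if "abs_torus x = abs_torus y" "w \<bullet> y \<notin> \<int>" for x y
    proof
      assume "w \<bullet> x \<in> \<int>"
      have "x - y \<in> int_vectors"
        using that(1) by (simp add: torus.abs_eq_iff torus_rel_def int_vectors_def)
      from Ints_diff[OF \<open>w \<bullet> x \<in> \<int>\<close> int[OF this]] that(2) show False
        by (simp add: inner_diff_right)
    qed
    then show ?thesis by (auto simp: V_def)
  qed
  moreover have "closed ((\<lambda>x. w \<bullet> x) -` \<int>)"
    by (intro closed_vimage closed_Ints continuous_intros)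
  then have "open {x. w \<bullet> x \<notin> \<int>}" by (simp add: closed_def vimage_def Compl_eq)
  ultimately have "open V" by (simp add: open_torus_def)
  moreover have "V \<inter> S = {}" using S by (auto simp: V_def)
  ultimately have "V \<inter> closure S = {}" by (simp add: open_Int_closure_eq_empty)
  moreover have "V \<noteq> {}"
  proof -
    have "w \<bullet> ((1 / (2 * (w \<bullet> w))) *\<^sub>R w) = 1/2" using \<open>w \<noteq> 0\<close> by simp
    moreover have "(1/2 :: real) \<notin> \<int>" by (auto elim!: Ints_cases simp: field_simps)
    ultimately show ?thesis unfolding V_def by (metis (mono_tags, lifting) empty_iff image_eqI mem_Collect_eq)
  qed
  ultimately show ?thesis by auto
qed

section \<open>The group of eventually integral vectors\<close>

lemma int_vectors_subgroup: "additive_subgroup int_vectors"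
  by unfold_locales (auto simp: int_vectors_def)

lemma int_matrix_int_vectors:
  "x \<in> int_vectors \<Longrightarrow> map_matrix of_int A *v x \<in> int_vectors"
  by (auto simp: int_vectors_def matrix_vector_mult_def intro!: Ints_sum Ints_mult)

lemma funpow_int_vectors:
  fixes A :: "int^'n^'n"
  shows "x \<in> int_vectors \<Longrightarrow> (((*v) (map_matrix of_int A)) ^^ n) x \<in> int_vectors"
  by (induction n) (auto simp: int_matrix_int_vectors)

lemma funpow_diff_vec:
  fixes M :: "real^'n^'n"
  shows "(((*v) M) ^^ n) (x - y) = (((*v) M) ^^ n) x - (((*v) M) ^^ n) y"
  by (induction n) (auto simp: matrix_vector_mult_diff_distrib)

lemma eventually_integral_subgroup: "additive_subgroup (eventually_integral A)"
proof
  interpret Z: additive_subgroup "int_vectors :: (real^'a) set" by (rule int_vectors_subgroup)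
  show "0 \<in> eventually_integral A"
    unfolding eventually_integral_def by (auto intro!: exI[of _ 0] Z.zero)
  fix x y assume "x \<in> eventually_integral A" "y \<in> eventually_integral A"
  then obtain m n where m: "(((*v) (map_matrix of_int A)) ^^ m) x \<in> int_vectors"
    and n: "(((*v) (map_matrix of_int A)) ^^ n) y \<in> int_vectors"
    by (auto simp: eventually_integral_def)
  have "(((*v) (map_matrix of_int A)) ^^ (m + n)) x \<in> int_vectors"
    using funpow_int_vectors[OF m, of n] by (simp add: add.commute[of m] funpow_add)
  moreover have "(((*v) (map_matrix of_int A)) ^^ (m + n)) y \<in> int_vectors"
    using funpow_int_vectors[OF n, of m] by (simp add: funpow_add)
  ultimately have "(((*v) (map_matrix of_int A)) ^^ (m + n)) (x - y) \<in> int_vectors"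
    by (simp add: funpow_diff_vec Z.diff)
  then show "x - y \<in> eventually_integral A" by (auto simp: eventually_integral_def)
qed

lemma int_vectors_subset_eventually_integral: "int_vectors \<subseteq> eventually_integral A"
  by (auto simp: eventually_integral_def intro: exI[of _ 0])

lemma span_int_vectors: "span (int_vectors :: (real^'n) set) = UNIV"
proof -
  have "Basis \<subseteq> (int_vectors :: (real^'n) set)"
    by (auto simp: int_vectors_def Basis_vec_def axis_def)
  then show ?thesis using span_mono span_Basis by (metis top.extremum_uniqueI)
qed

lemma eventually_integral_image_iff:
  "map_matrix of_int A *v x \<in> eventually_integral A \<longleftrightarrow> x \<in> eventually_integral A"
proof
  assume "map_matrix of_int A *v x \<in> eventually_integral A"
  then obtain n where "(((*v) (map_matrix of_int A)) ^^ n) (map_matrix of_int A *v x) \<in> int_vectors"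
    by (auto simp: eventually_integral_def)
  then have "(((*v) (map_matrix of_int A)) ^^ (Suc n)) x \<in> int_vectors"
    by (simp add: funpow_swap1)
  then show "x \<in> eventually_integral A" unfolding eventually_integral_def by blast
next
  assume "x \<in> eventually_integral A"
  then obtain n where "(((*v) (map_matrix of_int A)) ^^ n) x \<in> int_vectors"
    by (auto simp: eventually_integral_def)
  then have "(((*v) (map_matrix of_int A)) ^^ n) (map_matrix of_int A *v x) \<in> int_vectors"
    using int_matrix_int_vectors by (metis funpow_swap1)
  then show "map_matrix of_int A *v x \<in> eventually_integral A"
    unfolding eventually_integral_def by blast
qed

section \<open>Integral functionals and unit eigenvalues\<close>

text \<open>The chains below live on column vectors multiplied by the transpose, so its rewriting into
a product from the left is switched off.\<close>

declare transpose_matrix_vector [simp del]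

definition real_vec :: "int^'n \<Rightarrow> real^'n" where
  "real_vec u = (\<chi> i. of_int (u $ i))"

definition annihilator :: "int^'n^'n \<Rightarrow> (int^'n) set" where
  "annihilator A = {u. \<forall>x\<in>eventually_integral A. real_vec u \<bullet> x \<in> \<int>}"

lemma real_vec_inner_int_vectors: "x \<in> int_vectors \<Longrightarrow> real_vec w \<bullet> x \<in> \<int>"
  by (auto simp: real_vec_def int_vectors_def inner_vec_def intro!: Ints_sum Ints_mult)

lemma real_vec_transpose_inner:
  "real_vec (transpose A *v u) \<bullet> x = real_vec u \<bullet> (map_matrix of_int A *v x)"
proof -
  have "real_vec (transpose A *v u) = real_vec u v* map_matrix of_int A"
    by (simp add: real_vec_def vec_eq_iff matrix_vector_mult_def vector_matrix_mult_def transpose_def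
        mult.commute)
  then show ?thesis by (simp add: dot_lmul_matrix)
qed

lemma integral_functional_is_int:
  assumes "\<And>x. x \<in> int_vectors \<Longrightarrow> w \<bullet> x \<in> \<int>"
  shows "\<exists>u. w = real_vec u"
proof -
  have "w $ i \<in> \<int>" for i
    using assms[of "axis i 1"] by (simp add: int_vectors_def inner_axis) (simp add: axis_def)
  then have "\<forall>i. \<exists>k. w $ i = of_int k" by (metis Ints_cases)
  then obtain k where "\<And>i. w $ i = of_int (k i)" by metis
  then show ?thesis by (intro exI[of _ "\<chi> i. k i"]) (simp add: real_vec_def vec_eq_iff)
qed

text \<open>The preimage is \<open>u = w A\<^sup>-\<^sup>1\<close>.  It is again integral on the eventually integral vectors because
these are invariant under \<open>A\<^sup>-\<^sup>1\<close>, and evaluating it on the unit vectors shows that \<open>u\<close> is integral.\<close>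

lemma annihilator_step:
  assumes "invertible (map_matrix real_of_int A)" and w: "w \<in> annihilator A"
  shows "\<exists>u\<in>annihilator A. transpose A *v u = w"
proof -
  let ?M = "map_matrix real_of_int A"
  obtain N where N: "?M ** N = mat 1" using assms(1) by (auto simp: invertible_def)
  define y where "y = real_vec w v* N"
  have y: "y \<bullet> x = real_vec w \<bullet> (N *v x)" for x by (simp add: y_def dot_lmul_matrix)
  have MN: "?M *v (N *v x) = x" for x by (simp add: matrix_vector_mul_assoc N)
  have yG: "y \<bullet> x \<in> \<int>" if "x \<in> eventually_integral A" for x
  proof -
    have "N *v x \<in> eventually_integral A"
      using eventually_integral_image_iff[of A "N *v x"] that by (simp add: MN)
    then show ?thesis using w by (simp add: y annihilator_def)
  qed
  obtain u where u: "y = real_vec u"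
    using integral_functional_is_int yG int_vectors_subset_eventually_integral by blast
  have NM: "N *v (?M *v x) = x" for x
    using matrix_left_right_inverse[of ?M N] N by (simp add: matrix_vector_mul_assoc)
  have "real_vec (transpose A *v u) \<bullet> x = real_vec w \<bullet> x" for x
    by (simp add: real_vec_transpose_inner u[symmetric] y NM)
  then have "real_vec (transpose A *v u) = real_vec w" by (metis vector_eq_rdot)
  then have "transpose A *v u = w" by (simp add: real_vec_def vec_eq_iff)
  moreover have "u \<in> annihilator A" using yG u by (simp add: annihilator_def)
  ultimately show ?thesis by blast
qed

text \<open>Dividing \<open>w\<close> by the transpose \<open>T\<close> again and again gives a chain with \<open>T u\<^sub>n\<^sub>+\<^sub>1 = u\<^sub>n\<close>.  An integer
relation that expresses \<open>u\<^sub>k\<close> through its predecessors turns into \<open>q(T) u\<^sub>k = 0\<close> with \<open>q(0) = 1\<close>: the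
predecessors are \<open>T u\<^sub>k, T\<^sup>2 u\<^sub>k, ...\<close>, which contribute only higher terms.\<close>

lemma annihilator_imp_unit_eigenvalue:
  fixes A :: "int^'n^'n"
  assumes inv: "invertible (map_matrix real_of_int A)"
    and w: "w \<in> annihilator A" "w \<noteq> 0"
  shows "\<exists>l. is_eigenvalue (map_matrix of_int A) l \<and> algebraic_unit l"
proof -
  let ?T = "transpose A"
  have "\<exists>u. \<forall>n. (u n \<in> annihilator A \<and> u n \<noteq> 0) \<and> ?T *v u (Suc n) = u n"
  proof (rule dependent_nat_choice)
    show "\<exists>u. u \<in> annihilator A \<and> u \<noteq> 0" using w by blast
  next
    fix x n assume "x \<in> annihilator A \<and> x \<noteq> 0"
    then show "\<exists>y. (y \<in> annihilator A \<and> y \<noteq> 0) \<and> ?T *v y = x"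
      using annihilator_step[OF inv, of x] by force
  qed
  then obtain u where u0: "\<And>n. u n \<noteq> 0" and u: "\<And>n. ?T *v u (Suc n) = u n" by metis
  obtain k c where kc: "u k = (\<Sum>i<k. c i *s u i)" using int_vec_sequence_dependent by blast
  \<comment> \<open>Each further step of the chain multiplies the polynomial by \<open>X\<close> and adds a constant, as in the scheme of Horner.\<close>
  have horner: "\<exists>p. (\<Sum>i<j. c i *s u i) = ?T *v (matrix_poly p ?T *v u j)" for j
  proof (induction j)
    case 0 show ?case by (intro exI[of _ 0]) simp
  next
    case (Suc j)
    then obtain p where p: "(\<Sum>i<j. c i *s u i) = ?T *v (matrix_poly p ?T *v u j)" by blast
    have "(\<Sum>i<Suc j. c i *s u i) = matrix_poly (pCons (c j) p) ?T *v u j"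
      by (simp add: p matrix_vector_mult_add_rdistrib matrix_vector_mul_assoc add.commute)
    also have "\<dots> = ?T *v (matrix_poly (pCons (c j) p) ?T *v u (Suc j))"
      unfolding u[of j, symmetric] by (rule matrix_poly_commute_vec)
    finally show ?case by blast
  qed
  obtain p where p: "u k = ?T *v (matrix_poly p ?T *v u k)" using horner[of k] kc by auto
  define q where "q = pCons 1 (smult (-1) p)"
  have "matrix_poly q ?T *v u k = u k + ?T *v ((-1) *s (matrix_poly p ?T *v u k))"
    by (simp only: q_def matrix_poly_pCons matrix_vector_mult_add_rdistrib mat_mult_vec
        matrix_vector_mul_assoc[symmetric] matrix_poly_smult vector_smult_lid)
  also have "\<dots> = u k - u k"
    using p by (simp only: matrix_mult_scale_vec) (simp add: vec_eq_iff)
  finally have qu: "matrix_poly q ?T *v u k = 0" by simp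
  let ?q = "map_poly of_int q :: complex poly"
  let ?v = "(\<chi> i. of_int (u k $ i)) :: complex^'n"
  have "matrix_poly ?q (map_matrix of_int ?T) *v ?v = 0"
    unfolding map_matrix_of_int_poly[symmetric] map_matrix_mult_of_int qu
    by (simp add: vec_eq_iff)
  moreover have "?q \<noteq> 0" by (simp add: q_def map_poly_pCons)
  moreover have "?v \<noteq> 0" using u0[of k] by (auto simp: vec_eq_iff)
  ultimately obtain l where l: "poly ?q l = 0" "is_eigenvalue (map_matrix of_int ?T) l"
    using matrix_poly_kernel_imp_eigenvalue by blast
  have "map_matrix of_int ?T = transpose (map_matrix of_int A :: complex^'n^'n)"
    by (simp add: vec_eq_iff transpose_def)
  then have ev: "is_eigenvalue (map_matrix of_int A) l" using l(2) is_eigenvalue_transpose by metis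
  have l0: "l \<noteq> 0" using l(1) by (auto simp: q_def map_poly_pCons)
  \<comment> \<open>The reversed polynomial is monic because \<open>q(0) = 1\<close>, and it vanishes at \<open>1 / l\<close>.\<close>
  have "poly (reflect_poly ?q) (inverse l) = 0"
    using poly_reflect_poly_nz[of "inverse l" ?q] l0 l(1) by simp
  moreover have "reflect_poly ?q = map_poly of_int (reflect_poly q)"
    by (intro poly_eqI) (auto simp: coeff_reflect_poly coeff_map_poly degree_map_poly)
  moreover have "lead_coeff (reflect_poly q) = 1"
  proof -
    have "coeff (reflect_poly q) (degree q) = 1" by (simp add: coeff_reflect_poly q_def)
    moreover have "degree (reflect_poly q) = degree q"
      by (rule degree_reflect_poly_eq) (simp add: q_def)
    ultimately show ?thesis by simp
  qed
  ultimately have "algebraic_int (inverse l)"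
    by (intro algebraic_int_of_int_poly[of "reflect_poly q"]) auto
  then have "algebraic_unit l"
    using l0 eigenvalue_int_matrix_algebraic_int[OF ev] by (simp add: algebraic_unit_def field_simps)
  then show ?thesis using ev by blast
qed

text \<open>Reversing the monic polynomial of \<open>1/l\<close> gives \<open>r = 1 + X p\<close> with \<open>r(l) = 0\<close>.  On the integral
kernel \<open>K\<close> of \<open>r(T)\<close>, where \<open>T\<close> is the transpose of \<open>A\<close>, the inverse of \<open>T\<close> is \<open>-p(T)\<close>, which
preserves integrality and \<open>K\<close>.  So \<open>u \<bullet> x = u' \<bullet> A x\<close> with \<open>u'\<close> again in \<open>K\<close>, and \<open>n\<close> such steps
reach an integral \<open>A\<^sup>n x\<close>.\<close>

lemma unit_eigenvalue_imp_annihilator: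
  fixes A :: "int^'n^'n"
  assumes ev: "is_eigenvalue (map_matrix of_int A) l" and l: "l \<noteq> 0" "algebraic_int (1 / l)"
  shows "\<exists>w. w \<noteq> 0 \<and> w \<in> annihilator A"
proof -
  let ?T = "transpose A"
  obtain q where q: "poly (map_poly of_int q) (1/l) = 0" "lead_coeff q = 1"
    using l(2) by (auto simp: algebraic_int_altdef_ipoly)
  define r where "r = reflect_poly q"
  have "reflect_poly (map_poly of_int q :: complex poly) = map_poly of_int r"
    unfolding r_def by (intro poly_eqI) (auto simp: coeff_reflect_poly coeff_map_poly degree_map_poly)
  then have rl: "poly (map_poly of_int r) l = 0"
    using poly_reflect_poly_nz[of l "map_poly of_int q"] l(1) q(1) by (simp add: inverse_eq_divide)
  obtain p where r: "r = pCons 1 p"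
  proof (cases r)
    case (pCons a p)
    then have "a = coeff r 0" by simp
    also have "\<dots> = 1" using q(2) by (simp add: r_def)
    finally show ?thesis using that pCons by blast
  qed
  have "map_matrix of_int ?T = transpose (map_matrix of_int A :: complex^'n^'n)"
    by (simp add: vec_eq_iff transpose_def)
  then have "is_eigenvalue (map_matrix of_int ?T) l" using ev is_eigenvalue_transpose by metis
  then obtain v where v: "v \<noteq> 0" "map_matrix of_int ?T *v v = l *s v"
    by (auto simp: is_eigenvalue_def)
  have "map_matrix of_int (matrix_poly r ?T) *v v = 0"
    unfolding map_matrix_of_int_poly matrix_poly_eigenvector[OF v(2)] rl by (simp add: vec_eq_iff)
  then have "det (map_matrix of_int (matrix_poly r ?T) :: complex^'n^'n) = 0"
    using v(1) singular_iff_kernel by blast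
  then have "det (matrix_poly r ?T) = 0" by (simp add: det_map_of_int)
  then obtain w where w: "w \<noteq> 0" "matrix_poly r ?T *v w = 0"
    using singular_int_matrix_kernel by blast
  define K where "K = {u. matrix_poly r ?T *v u = 0}"
  have step: "\<exists>u'\<in>K. u = ?T *v u'" if "u \<in> K" for u
  proof
    let ?u' = "matrix_poly (smult (-1) p) ?T *v u"
    have "u + ?T *v (matrix_poly p ?T *v u) = 0"
      using that by (simp add: K_def r matrix_vector_mult_add_rdistrib matrix_vector_mul_assoc)
    then have "?T *v (matrix_poly p ?T *v u) = - u" by (simp add: add_eq_0_iff)
    then show "u = ?T *v ?u'"
      by (simp only: matrix_poly_smult matrix_mult_scale_vec) (simp add: vec_eq_iff)
    have "matrix_poly r ?T *v ?u' = matrix_poly (smult (-1) p) ?T *v (matrix_poly r ?T *v u)"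
      by (simp only: matrix_poly_mult[symmetric] mult.commute)
    then show "?u' \<in> K" using that by (simp add: K_def)
  qed
  \<comment> \<open>Each step trades one application of \<open>A\<close> to \<open>x\<close> against a division of \<open>u\<close> by \<open>T\<close>.\<close>
  have "\<forall>u\<in>K. real_vec u \<bullet> x \<in> \<int>" if "(((*v) (map_matrix of_int A)) ^^ n) x \<in> int_vectors" for n x
    using that
  proof (induction n arbitrary: x)
    case 0 then show ?case by (simp add: real_vec_inner_int_vectors)
  next
    case (Suc n)
    show ?case
    proof
      fix u assume "u \<in> K"
      then obtain u' where u': "u' \<in> K" "u = ?T *v u'" using step by blast
      have "real_vec u' \<bullet> (map_matrix of_int A *v x) \<in> \<int>"
        using Suc.IH[of "map_matrix of_int A *v x"] Suc.prems u'(1) by (simp add: funpow_swap1)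
      then show "real_vec u \<bullet> x \<in> \<int>" unfolding u'(2) by (simp add: real_vec_transpose_inner)
    qed
  qed
  then have "w \<in> annihilator A" using w(2) by (auto simp: annihilator_def eventually_integral_def K_def)
  then show ?thesis using w(1) by blast
qed

theorem theorem2p7:
  fixes A :: "int^'n^'n"
  assumes "invertible (map_matrix real_of_int A)"
  shows "closure {x :: 'n torus. \<exists>n::nat. (torus_endo A ^^ n) x = 0} \<noteq> UNIV
    \<longleftrightarrow> (\<exists>l::complex. is_eigenvalue (map_matrix of_int A) l \<and> algebraic_unit l)"
proof
  let ?S = "{x :: 'n torus. \<exists>n::nat. (torus_endo A ^^ n) x = 0}"
  let ?H = "eventually_integral A"
  assume "closure ?S \<noteq> UNIV"
  then have "closure ?H \<noteq> UNIV"
    using closure_vimage_abs_torus_neq_UNIV vimage_torsion_eq_eventually_integral by metis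
  moreover have "span ?H = UNIV"
    using span_mono[OF int_vectors_subset_eventually_integral] span_int_vectors by blast
  ultimately obtain y where y: "y \<noteq> 0" "\<And>h. h \<in> ?H \<Longrightarrow> y \<bullet> h \<in> \<int>"
    using nondense_subgroup_annihilator[OF eventually_integral_subgroup] by blast
  obtain w where w: "y = real_vec w"
    using integral_functional_is_int y(2) int_vectors_subset_eventually_integral by blast
  have "w \<in> annihilator A" using y(2) w by (simp add: annihilator_def)
  moreover have "w \<noteq> 0" using y(1) w by (auto simp: real_vec_def vec_eq_iff)
  ultimately show "\<exists>l. is_eigenvalue (map_matrix of_int A) l \<and> algebraic_unit l"
    using annihilator_imp_unit_eigenvalue[OF assms] by blast
next
  assume "\<exists>l. is_eigenvalue (map_matrix of_int A) l \<and> algebraic_unit l"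
  then obtain w where w: "w \<noteq> 0" "w \<in> annihilator A"
    using unit_eigenvalue_imp_annihilator by (auto simp: algebraic_unit_def)
  show "closure {x :: 'n torus. \<exists>n::nat. (torus_endo A ^^ n) x = 0} \<noteq> UNIV"
  proof (rule not_dense_torus_if_functional[of "real_vec w"])
    show "real_vec w \<noteq> 0" using w(1) by (auto simp: real_vec_def vec_eq_iff)
    show "real_vec w \<bullet> x \<in> \<int>" if "x \<in> int_vectors" for x using that by (rule real_vec_inner_int_vectors)
    show "real_vec w \<bullet> x \<in> \<int>" if "abs_torus x \<in> {x. \<exists>n. (torus_endo A ^^ n) x = 0}" for x
      using w(2) that vimage_torsion_eq_eventually_integral[of A] by (auto simp: annihilator_def)
  qed
qed

end
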